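(* Let $\theta^\star\in\Theta$ be a local maximizer of the likelihood function $\mathcal{L}:\Theta\to\mathbb{R}$. Then there exists $\delta_0>0$ such that for every $\delta\in(0,\delta_0)$, $\theta^\star$ is an equilibrium of the discrete-time dynamical system $\theta[k+1]=F^{\delta\text{-}\mathrm{EM}}(\theta[k])$, $k\in\{0,1,2,\dots\}$; that is, $F^{\delta\text{-}\mathrm{EM}}(\theta^\star)=\theta^\star$.
   Context: Setting: $\Theta\subseteq\mathbb{R}^p$ is a parameter set and $y\in\mathbb{R}^m$ is a fixed data vector. For each $\theta\in\Theta$, $p_\theta(x,y)$ is a joint probability density in $(x,y)\in\mathbb{R}^n\times\mathbb{R}^m$, with marginal $p_\theta(y)=\int p_\theta(x,y)\,dx$. The likelihood function is $\mathcal{L}:\Theta\to\mathbb{R}$, $\mathcal{L}(\theta)=p_\theta(y)$, and $p_\theta(x|y)=p_\theta(x,y)/p_\theta(y)$. All random vectors are continuous (have densities). Standing assumptions: (i) $\mathcal{L}(\theta)>0$ for every $\theta\in\Theta$. (ii) The set $\mathcal{X}=\{x\in\mathbb{R}^n: p_\theta(x,y)>0\}$ does not depend on $\theta\in\Theta$. The function $Q:\Theta\times\Theta\to\mathbb{R}$ is defined by $Q(\theta,\theta')=\int_{\mathcal{X}}p_{\theta'}(x|y)\log p_\theta(x,y)\,dx$. (iii) For every $\theta'\in\Theta$ and every $\delta>0$, $Q(\cdot,\theta')$ has a unique global maximizer in $B_\delta(\theta')\cap\Theta$, where $B_\delta(\theta')=\{\theta\in\mathbb{R}^p:\|\theta-\theta'\|<\delta\}$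 (Euclidean norm); for $\delta>0$, $F^{\delta\text{-}\mathrm{EM}}:\Theta\to\Theta$ is defined by $F^{\delta\text{-}\mathrm{EM}}(\theta')=\operatorname{argmax}_{\theta\in B_\delta(\theta')\cap\Theta}Q(\theta,\theta')$. An equilibrium of $\theta[k+1]=F(\theta[k])$ is a point $\theta^\star\in\Theta$ with $F(\theta^\star)=\theta^\star$. *)

theory Defs
  imports "HOL-Analysis.Analysis"
begin

definition prob_density :: "('a::euclidean_space \<Rightarrow> real) \<Rightarrow> bool" where
  "prob_density f \<longleftrightarrow>
     f \<in> borel_measurable borel \<and> (\<forall>z. 0 \<le> f z) \<and> (\<integral>\<^sup>+ z. ennreal (f z) \<partial>lborel) = 1"

(* The Bochner integral is 0 when the integral diverges, so a positive marginal is
   automatically a finite one. *)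
definition marginal ::
    "('t \<Rightarrow> 'a::euclidean_space \<times> 'b::euclidean_space \<Rightarrow> real) \<Rightarrow> 't \<Rightarrow> 'b \<Rightarrow> real" where
  "marginal p \<theta> y = (LINT x|lborel. p \<theta> (x, y))"

definition likelihood ::
    "('t \<Rightarrow> 'a::euclidean_space \<times> 'b::euclidean_space \<Rightarrow> real) \<Rightarrow> 'b \<Rightarrow> 't \<Rightarrow> real" where
  "likelihood p y \<theta> = marginal p \<theta> y"

definition cond_density ::
    "('t \<Rightarrow> 'a::euclidean_space \<times> 'b::euclidean_space \<Rightarrow> real) \<Rightarrow> 't \<Rightarrow> 'a \<Rightarrow> 'b \<Rightarrow> real" where
  "cond_density p \<theta> x y = p \<theta> (x, y) / marginal p \<theta> y"

definition Q_integrand ::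
    "('t \<Rightarrow> 'a::euclidean_space \<times> 'b::euclidean_space \<Rightarrow> real) \<Rightarrow> 'b \<Rightarrow> 't \<Rightarrow> 't \<Rightarrow> 'a \<Rightarrow> real"
  where "Q_integrand p y \<theta> \<theta>' x = cond_density p \<theta>' x y * ln (p \<theta> (x, y))"

(* X is the set of all x with positive joint density at the data y, common to all parameters. *)
definition Q_fun ::
    "('t \<Rightarrow> 'a::euclidean_space \<times> 'b::euclidean_space \<Rightarrow> real) \<Rightarrow> 'b \<Rightarrow> 'a set \<Rightarrow> 't \<Rightarrow> 't \<Rightarrow> real"
  where "Q_fun p y X \<theta> \<theta>' = (LINT x:X|lborel. Q_integrand p y \<theta> \<theta>' x)"

(* arg_max_on picks some maximizer; it is the argmax proper wherever the maximizer is unique. *)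
definition delta_EM ::
    "('t::metric_space \<Rightarrow> 'a::euclidean_space \<times> 'b::euclidean_space \<Rightarrow> real) \<Rightarrow> 'b \<Rightarrow> 'a set \<Rightarrow>
     't set \<Rightarrow> real \<Rightarrow> 't \<Rightarrow> 't"
  where "delta_EM p y X \<Theta> \<delta> \<theta>' = arg_max_on (\<lambda>\<theta>. Q_fun p y X \<theta> \<theta>') (ball \<theta>' \<delta> \<inter> \<Theta>)"

definition local_maximizer_on :: "'t::metric_space set \<Rightarrow> ('t \<Rightarrow> real) \<Rightarrow> 't \<Rightarrow> bool" where
  "local_maximizer_on S f z \<longleftrightarrow> z \<in> S \<and> (\<exists>\<epsilon>>0. \<forall>x \<in> ball z \<epsilon> \<inter> S. f x \<le> f z)"

definition equilibrium_on :: "'t set \<Rightarrow> ('t \<Rightarrow> 't) \<Rightarrow> 't \<Rightarrow> bool" where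
  "equilibrium_on S F z \<longleftrightarrow> z \<in> S \<and> F z = z"

end

theory Submission
  imports Defs
begin

text \<open>
  Raising \<open>Q(\<cdot>, \<theta>')\<close> above its value at \<open>\<theta>'\<close> forces the likelihood up as well. Since
  \<open>p\<^sub>\<theta>\<^sub>'(x|y)\<close> is \<open>p\<^sub>\<theta>\<^sub>'(x, y) / L(\<theta>')\<close>, the tangent bound \<open>ln t \<le> t - 1\<close> at the ratio
  \<open>t = p\<^sub>\<theta>(x, y) / p\<^sub>\<theta>\<^sub>'(x, y)\<close> gives, pointwise on \<open>X\<close>,
  \<open>p\<^sub>\<theta>\<^sub>'(x|y) (ln p\<^sub>\<theta>(x, y) - ln p\<^sub>\<theta>\<^sub>'(x, y)) \<le> (p\<^sub>\<theta>(x, y) - p\<^sub>\<theta>\<^sub>'(x, y)) / L(\<theta>')\<close>.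
  Both joint densities vanish off \<open>X\<close>, so integrating yields
  \<open>Q(\<theta>, \<theta>') - Q(\<theta>', \<theta>') \<le> (L(\<theta>) - L(\<theta>')) / L(\<theta>')\<close>, which is lemma \<open>Q_fun_diff_le\<close>.

  Let \<open>L\<close> be maximal at \<open>\<theta>s\<close> among the parameters in a ball around \<open>\<theta>s\<close>. There the
  right-hand side for \<open>\<theta>' = \<theta>s\<close> is nonpositive, so \<open>\<theta>s\<close> maximizes \<open>Q(\<cdot>, \<theta>s)\<close> over that
  ball and over every smaller one. As the maximizer is unique, the argmax is \<open>\<theta>s\<close> itself,
  and the radius of the ball serves as \<open>\<delta>\<^sub>0\<close>.
\<close>

lemma ln_diff_weighted_le:
  fixes a b c :: real
  assumes "0 < a" "0 < b" "0 < c"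
  shows "b / c * ln a - b / c * ln b \<le> (a - b) / c"
proof -
  have "b / c * ln a - b / c * ln b = b / c * ln (a / b)"
    using assms by (simp add: ln_div right_diff_distrib)
  also have "\<dots> \<le> b / c * (a / b - 1)"
    using assms by (intro mult_left_mono ln_le_minus_one) auto
  also have "\<dots> = (a - b) / c"
    using assms by (simp add: field_simps)
  finally show ?thesis .
qed

text \<open>
  The Bochner integral of a non-integrable function is \<open>0\<close>, so a positive likelihood
  already certifies that \<open>p\<^sub>\<theta>(\<cdot>, y)\<close> is integrable. Restricting the integral to \<open>X\<close> loses
  nothing because a nonnegative function vanishes where it is not positive.
\<close>

lemma likelihood_has_support_integral:
  fixes p :: "'t \<Rightarrow> 'a::euclidean_space \<times> 'b::euclidean_space \<Rightarrow> real"
  assumes nonneg: "\<And>z. 0 \<le> p \<theta> z"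
    and pos: "0 < likelihood p y \<theta>"
    and support: "{x. 0 < p \<theta> (x, y)} = X"
  shows "set_integrable lborel X (\<lambda>x. p \<theta> (x, y))"
    and "(LINT x:X|lborel. p \<theta> (x, y)) = likelihood p y \<theta>"
proof -
  have eq: "(\<lambda>x. indicator X x *\<^sub>R p \<theta> (x, y)) = (\<lambda>x. p \<theta> (x, y))"
  proof
    fix x
    show "indicator X x *\<^sub>R p \<theta> (x, y) = p \<theta> (x, y)"
      using nonneg[of "(x, y)"] by (auto simp: support[symmetric] indicator_def)
  qed
  have "integrable lborel (\<lambda>x. p \<theta> (x, y))"
    using pos not_integrable_integral_eq
    by (fastforce simp: likelihood_def marginal_def)
  then show "set_integrable lborel X (\<lambda>x. p \<theta> (x, y))"
    by (simp only: set_integrable_def eq)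
  show "(LINT x:X|lborel. p \<theta> (x, y)) = likelihood p y \<theta>"
    by (simp only: set_lebesgue_integral_def eq likelihood_def marginal_def)
qed

text \<open>
  The ascent property of EM. Bounding the logarithm linearly before normalizing leads to
  the relative increase of \<open>L\<close>, and not to the sharper \<open>ln L(\<theta>) - ln L(\<theta>')\<close> of Jensen's
  inequality; the two have the same sign, and only the sign matters for maximizers.
\<close>

lemma Q_fun_diff_le:
  fixes p :: "'t \<Rightarrow> 'a::euclidean_space \<times> 'b::euclidean_space \<Rightarrow> real"
  assumes nonneg: "\<And>z. 0 \<le> p \<theta> z" "\<And>z. 0 \<le> p \<theta>' z"
    and pos: "0 < likelihood p y \<theta>" "0 < likelihood p y \<theta>'"
    and support: "{x. 0 < p \<theta> (x, y)} = X" "{x. 0 < p \<theta>' (x, y)} = X"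
    and int: "set_integrable lborel X (Q_integrand p y \<theta> \<theta>')"
      "set_integrable lborel X (Q_integrand p y \<theta>' \<theta>')"
  shows "Q_fun p y X \<theta> \<theta>' - Q_fun p y X \<theta>' \<theta>'
           \<le> (likelihood p y \<theta> - likelihood p y \<theta>') / likelihood p y \<theta>'"
proof -
  let ?L = "likelihood p y \<theta>'"
  note supp = likelihood_has_support_integral[OF nonneg(1) pos(1) support(1)]
  note supp' = likelihood_has_support_integral[OF nonneg(2) pos(2) support(2)]
  have "Q_fun p y X \<theta> \<theta>' - Q_fun p y X \<theta>' \<theta>'
      = (LINT x:X|lborel. Q_integrand p y \<theta> \<theta>' x - Q_integrand p y \<theta>' \<theta>' x)"
    using int by (simp add: Q_fun_def set_integral_diff)
  also have "\<dots> \<le> (LINT x:X|lborel. (p \<theta> (x, y) - p \<theta>' (x, y)) / ?L)"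
  proof (rule set_integral_mono)
    show "set_integrable lborel X (\<lambda>x. Q_integrand p y \<theta> \<theta>' x - Q_integrand p y \<theta>' \<theta>' x)"
      using int by (rule set_integral_diff)
    show "set_integrable lborel X (\<lambda>x. (p \<theta> (x, y) - p \<theta>' (x, y)) / ?L)"
      using supp(1) supp'(1) by (intro set_integrable_divide set_integral_diff) auto
    fix x assume "x \<in> X"
    then have "0 < p \<theta> (x, y)" "0 < p \<theta>' (x, y)"
      using support by auto
    then show "Q_integrand p y \<theta> \<theta>' x - Q_integrand p y \<theta>' \<theta>' x
        \<le> (p \<theta> (x, y) - p \<theta>' (x, y)) / ?L"
      using ln_diff_weighted_le pos(2)
      by (simp add: Q_integrand_def cond_density_def likelihood_def)
  qed
  also have "\<dots> = (likelihood p y \<theta> - ?L) / ?L"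
    using supp supp' by (simp add: set_integral_diff)
  finally show ?thesis .
qed

theorem proposition2:
  fixes \<Theta> :: "(real ^ 'p) set"
    and p :: "real ^ 'p \<Rightarrow> (real ^ 'n) \<times> (real ^ 'm) \<Rightarrow> real"
    and y :: "real ^ 'm"
    and X :: "(real ^ 'n) set"
    and \<theta>s :: "real ^ 'p"
  assumes density: "\<And>\<theta>. \<theta> \<in> \<Theta> \<Longrightarrow> prob_density (p \<theta>)"
    and likelihood_pos: "\<And>\<theta>. \<theta> \<in> \<Theta> \<Longrightarrow> 0 < likelihood p y \<theta>"
    and support: "\<And>\<theta>. \<theta> \<in> \<Theta> \<Longrightarrow> {x. 0 < p \<theta> (x, y)} = X"
    and Q_well_defined: "\<And>\<theta> \<theta>'. \<theta> \<in> \<Theta> \<Longrightarrow> \<theta>' \<in> \<Theta> \<Longrightarrow>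
           set_integrable lborel X (Q_integrand p y \<theta> \<theta>')"
    and unique_maximizer: "\<And>\<theta>' \<delta>. \<theta>' \<in> \<Theta> \<Longrightarrow> 0 < \<delta> \<Longrightarrow>
           \<exists>!\<theta>. is_arg_max (\<lambda>\<theta>. Q_fun p y X \<theta> \<theta>') (\<lambda>\<theta>. \<theta> \<in> ball \<theta>' \<delta> \<inter> \<Theta>) \<theta>"
    and local_max: "local_maximizer_on \<Theta> (likelihood p y) \<theta>s"
  shows "\<exists>\<delta>\<^sub>0>0. \<forall>\<delta>\<in>{0<..<\<delta>\<^sub>0}. equilibrium_on \<Theta> (delta_EM p y X \<Theta> \<delta>) \<theta>s"
proof -
  obtain \<epsilon> where \<epsilon>: "0 < \<epsilon>" and s: "\<theta>s \<in> \<Theta>"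
    and max: "\<And>\<theta>. \<theta> \<in> ball \<theta>s \<epsilon> \<inter> \<Theta> \<Longrightarrow> likelihood p y \<theta> \<le> likelihood p y \<theta>s"
    using local_max unfolding local_maximizer_on_def by blast
  have nonneg: "0 \<le> p \<theta> z" if "\<theta> \<in> \<Theta>" for \<theta> z
    using density[OF that] unfolding prob_density_def by blast
  have Q_max: "Q_fun p y X \<theta> \<theta>s \<le> Q_fun p y X \<theta>s \<theta>s" if "\<theta> \<in> ball \<theta>s \<epsilon> \<inter> \<Theta>" for \<theta>
  proof -
    have "\<theta> \<in> \<Theta>"
      using that by simp
    then have "Q_fun p y X \<theta> \<theta>s - Q_fun p y X \<theta>s \<theta>s
        \<le> (likelihood p y \<theta> - likelihood p y \<theta>s) / likelihood p y \<theta>s"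
      using s by (intro Q_fun_diff_le nonneg likelihood_pos support Q_well_defined)
    also have "\<dots> \<le> 0"
      using max[OF that] likelihood_pos[OF s] by (simp add: divide_nonpos_pos)
    finally show ?thesis
      by simp
  qed
  have "equilibrium_on \<Theta> (delta_EM p y X \<Theta> \<delta>) \<theta>s" if "\<delta> \<in> {0<..<\<epsilon>}" for \<delta>
  proof -
    let ?arg_max = "is_arg_max (\<lambda>\<theta>. Q_fun p y X \<theta> \<theta>s) (\<lambda>\<theta>. \<theta> \<in> ball \<theta>s \<delta> \<inter> \<Theta>)"
    have "?arg_max \<theta>s"
      using Q_max s that by (force simp: is_arg_max_linorder)
    moreover have "\<exists>!\<theta>. ?arg_max \<theta>"
      using unique_maximizer[OF s] that by simp
    ultimately have "(SOME \<theta>. ?arg_max \<theta>) = \<theta>s"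
      by (metis (no_types, lifting) someI)
    then show ?thesis
      using s by (simp add: equilibrium_on_def delta_EM_def arg_max_on_def arg_max_def)
  qed
  then show ?thesis
    using \<epsilon> by blast
qed

end
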